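(* Let $f:\mathbb{R}^n\to\mathbb{R}^n$ be a function, $F:\mathbb{R}^n\rightrightarrows\mathbb{R}^n$ a set-valued map and $p:[0,1]\to\mathbb{R}^n$ a function. For $t\in[0,1]$ let $G_t(v)=f(v)-p(t)+F(v)$ and $S(t)=\{z\in\mathbb{R}^n : 0\in G_t(z)\}$. Assume that (i) $z:[0,1]\to\mathbb{R}^n$ is a Lipschitz continuous solution trajectory with Lipschitz constant $L_z$, i.e. $z$ is Lipschitz with constant $L_z$ and $z(t)\in S(t)$ for all $t\in[0,1]$; (ii) $p$ is Lipschitz continuous with Lipschitz constant $L_p$; (iii) for every $t\in[0,1]$, $G_t$ is strongly metrically regular at $z(t)$ for $0$. Then there exist constants $a,b,\kappa>0$ such that for every $t\in[0,1]$ the mapping $$\mathbb{B}_b(0)\ni y\longmapsto G_t^{-1}(y)\cap\mathbb{B}_a(z(t))$$ is single-valued and Lipschitz continuous with Lipschitz constant $\kappa$.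
   Context: For a set-valued map $H:\mathbb{R}^n\rightrightarrows\mathbb{R}^n$, $H^{-1}(y)=\{x: y\in H(x)\}$. $\mathbb{B}_r(x)$ denotes the closed ball of radius $r$ centred at $x$. "Single-valued" means that the set has exactly one element for each $y$ in the indicated ball. $G_t$ is strongly metrically regular at $z(t)$ for $0$ if $0\in G_t(z(t))$ and there exist constants $a_t,b_t,\kappa_t>0$ (possibly depending on $t$) such that the mapping $\mathbb{B}_{b_t}(0)\ni y\mapsto G_t^{-1}(y)\cap\mathbb{B}_{a_t}(z(t))$ is single-valued and Lipschitz continuous with Lipschitz constant $\kappa_t$. *)

theory Defs
  imports "HOL-Analysis.Analysis"
begin

definition setmap_inverse :: "('a \<Rightarrow> 'b set) \<Rightarrow> 'b \<Rightarrow> 'a set" where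
  "setmap_inverse H y = {x. y \<in> H x}"

definition single_valued_on :: "'a set \<Rightarrow> ('a \<Rightarrow> 'b set) \<Rightarrow> bool" where
  "single_valued_on D H \<longleftrightarrow> (\<forall>y\<in>D. \<exists>!x. x \<in> H y)"

text \<open>Lipschitz continuity of a single-valued map refers to the function selecting the unique
  element; \<^const>\<open>the_elem\<close> is meaningful on \<open>D\<close> because of the first conjunct.\<close>

definition single_valued_lipschitz_on ::
    "real \<Rightarrow> 'a::metric_space set \<Rightarrow> ('a \<Rightarrow> 'b::metric_space set) \<Rightarrow> bool" where
  "single_valued_lipschitz_on \<kappa> D H \<longleftrightarrow>
     single_valued_on D H \<and> \<kappa>-lipschitz_on D (\<lambda>y. the_elem (H y))"

definition strongly_metrically_regular ::
    "('a::metric_space \<Rightarrow> 'b::metric_space set) \<Rightarrow> 'a \<Rightarrow> 'b \<Rightarrow> bool" where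
  "strongly_metrically_regular H x\<^sub>0 y\<^sub>0 \<longleftrightarrow>
     y\<^sub>0 \<in> H x\<^sub>0 \<and>
     (\<exists>a>0. \<exists>b>0. \<exists>\<kappa>>0.
        single_valued_lipschitz_on \<kappa> (cball y\<^sub>0 b) (\<lambda>y. setmap_inverse H y \<inter> cball x\<^sub>0 a))"

definition gen_eq_map ::
    "('a::ab_group_add \<Rightarrow> 'a) \<Rightarrow> ('a \<Rightarrow> 'a set) \<Rightarrow> (real \<Rightarrow> 'a) \<Rightarrow> real \<Rightarrow> 'a \<Rightarrow> 'a set" where
  "gen_eq_map f F p t v = {f v - p t + w | w. w \<in> F v}"

definition solution_set ::
    "('a::ab_group_add \<Rightarrow> 'a) \<Rightarrow> ('a \<Rightarrow> 'a set) \<Rightarrow> (real \<Rightarrow> 'a) \<Rightarrow> real \<Rightarrow> 'a set" where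
  "solution_set f F p t = {v. 0 \<in> gen_eq_map f F p t v}"

end

theory Submission imports Defs begin

text \<open>All the maps \<open>G\<^sub>t\<close> are vertical translates of \<open>f + F\<close>, so the localization witnessing strong
  regularity at \<open>t\<^sub>0\<close> also serves, with the same Lipschitz constant and smaller radii, at every
  \<open>t\<close> near \<open>t\<^sub>0\<close>; the trajectory stays on the corresponding branch by uniqueness. Compactness of
  \<open>[0,1]\<close> then makes the constants uniform. Since shrinking the radius \<open>a\<close> of the target ball forces
  \<open>\<kappa> b \<le> a\<close>, the constants are encoded by a single number \<open>N\<close> whose increase preserves the property.\<close>

text \<open>Trades \<open>the_elem\<close> for an explicit selection \<open>g\<close>. Later proofs
  build or restrict \<open>g\<close> and use this equivalence in both directions.\<close>

lemma single_valued_lipschitz_on_iff: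
  "single_valued_lipschitz_on k D H \<longleftrightarrow> (\<exists>g. (\<forall>y\<in>D. H y = {g y}) \<and> k-lipschitz_on D g)"
proof
  assume H: "single_valued_lipschitz_on k D H"
  have "H y = {the_elem (H y)}" if "y \<in> D" for y
  proof -
    have "\<exists>!x. x \<in> H y"
      using H that unfolding single_valued_lipschitz_on_def single_valued_on_def by (elim conjE bspec)
    then obtain x where "x \<in> H y" "\<forall>x'. x' \<in> H y \<longrightarrow> x' = x" by (rule ex1E)
    then have "H y = {x}" by blast
    then show ?thesis by (simp only: the_elem_eq)
  qed
  moreover have "k-lipschitz_on D (\<lambda>y. the_elem (H y))"
    using H unfolding single_valued_lipschitz_on_def by (rule conjunct2)
  ultimately show "\<exists>g. (\<forall>y\<in>D. H y = {g y}) \<and> k-lipschitz_on D g"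
    by (intro exI[of _ "\<lambda>y. the_elem (H y)"] conjI ballI)
next
  assume "\<exists>g. (\<forall>y\<in>D. H y = {g y}) \<and> k-lipschitz_on D g"
  then obtain g where g: "\<forall>y\<in>D. H y = {g y}" "k-lipschitz_on D g" by (elim exE conjE)
  have "k-lipschitz_on D (\<lambda>y. the_elem (H y))"
    using g(2) by (rule lipschitz_on_transform) (simp add: g(1))
  moreover have "single_valued_on D H"
    unfolding single_valued_on_def using g(1) by simp
  ultimately show "single_valued_lipschitz_on k D H"
    unfolding single_valued_lipschitz_on_def by (intro conjI)
qed

lemma single_valued_lipschitz_on_mono:
  assumes "single_valued_lipschitz_on k D H" "k \<le> k'"
  shows "single_valued_lipschitz_on k' D H"
  using assms lipschitz_on_le[of k D "\<lambda>y. the_elem (H y)" k']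
  unfolding single_valued_lipschitz_on_def by simp

lemma single_valued_lipschitz_on_translate:
  fixes h :: "'a::real_normed_vector"
  assumes "single_valued_lipschitz_on k (cball h b) H"
  shows "single_valued_lipschitz_on k (cball 0 b) (\<lambda>y. H (y + h))"
proof -
  obtain g where g: "\<And>y. y \<in> cball h b \<Longrightarrow> H y = {g y}" "k-lipschitz_on (cball h b) g"
    using assms unfolding single_valued_lipschitz_on_iff by blast
  have shift: "y + h \<in> cball h b" if "y \<in> cball 0 b" for y
    using that by (simp add: dist_norm)
  have "k-lipschitz_on (cball 0 b) (\<lambda>y. g (y + h))"
  proof (rule lipschitz_onI)
    show "dist (g (x + h)) (g (y + h)) \<le> k * dist x y" if "x \<in> cball 0 b" "y \<in> cball 0 b" for x y
      using lipschitz_onD[OF g(2) shift[OF that(1)] shift[OF that(2)]] by simp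
    show "0 \<le> k" using g(2) by (rule lipschitz_on_nonneg)
  qed
  with g(1) shift show ?thesis
    unfolding single_valued_lipschitz_on_iff by (intro exI[of _ "\<lambda>y. g (y + h)"] conjI ballI) simp_all
qed

text \<open>The old selection \<open>g\<close> also serves at the new reference point. The new balls
  lie inside the old ones, so at most one preimage survives. Existence follows from
  \<open>g y = x\<close>: the Lipschitz bound keeps \<open>g\<close> within
  \<open>k * b \<le> a\<close> of \<open>x\<close> on the ball of radius \<open>b\<close>.\<close>

lemma inverse_localization_nearby:
  fixes x\<^sub>0 x :: "'a::metric_space" and y\<^sub>0 y :: "'b::metric_space"
  assumes loc: "single_valued_lipschitz_on k (cball y\<^sub>0 b\<^sub>0) (\<lambda>v. setmap_inverse H v \<inter> cball x\<^sub>0 a\<^sub>0)"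
    and y: "y \<in> H x"
    and x_near: "dist x\<^sub>0 x + a \<le> a\<^sub>0" and y_near: "dist y\<^sub>0 y + b \<le> b\<^sub>0"
    and a: "0 \<le> a" "k * b \<le> a" and b: "0 \<le> b"
  shows "single_valued_lipschitz_on k (cball y b) (\<lambda>v. setmap_inverse H v \<inter> cball x a)"
proof -
  obtain g where g: "\<And>v. v \<in> cball y\<^sub>0 b\<^sub>0 \<Longrightarrow> setmap_inverse H v \<inter> cball x\<^sub>0 a\<^sub>0 = {g v}"
    and lip: "k-lipschitz_on (cball y\<^sub>0 b\<^sub>0) g"
    using loc unfolding single_valued_lipschitz_on_iff by blast
  have sub_x: "cball x a \<subseteq> cball x\<^sub>0 a\<^sub>0"
    unfolding subset_iff mem_cball
    using x_near by (metis add_left_mono dist_triangle order_trans)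
  have sub_y: "cball y b \<subseteq> cball y\<^sub>0 b\<^sub>0"
    unfolding subset_iff mem_cball
    using y_near by (metis add_left_mono dist_triangle order_trans)
  have y_in: "y \<in> cball y b" and x_in: "x \<in> cball x a" using a b by auto
  then have "x \<in> setmap_inverse H y \<inter> cball x\<^sub>0 a\<^sub>0"
    using sub_x y unfolding setmap_inverse_def by blast
  \<comment> \<open>Both points are preimages of \<open>y\<close> in the old ball, where there is
    only one.\<close>
  then have gy: "g y = x"
    unfolding g[OF subsetD[OF sub_y y_in]] by simp
  have "setmap_inverse H v \<inter> cball x a = {g v}" if v: "v \<in> cball y b" for v
  proof -
    have "dist x (g v) \<le> k * dist y v"
      using lipschitz_onD[OF lip subsetD[OF sub_y y_in] subsetD[OF sub_y v]] by (simp only: gy)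
    also have "\<dots> \<le> k * b"
      using v lipschitz_on_nonneg[OF lip] by (simp add: mult_left_mono)
    finally have "g v \<in> cball x a" using a by simp
    moreover have "setmap_inverse H v \<inter> cball x\<^sub>0 a\<^sub>0 = {g v}"
      using subsetD[OF sub_y v] by (rule g)
    ultimately show ?thesis using sub_x by blast
  qed
  with lipschitz_on_subset[OF lip sub_y] show ?thesis
    unfolding single_valued_lipschitz_on_iff by (intro exI[of _ g] conjI ballI)
qed

text \<open>\<open>N\<close> bounds the Lipschitz constant, the reciprocals of both radii and the
  admissible ratio \<open>a / b\<close> from below. Quantifying over all such radii, instead of
  fixing one pair, gives monotonicity: a larger \<open>N\<close> admits fewer pairs and weakens the
  Lipschitz bound.\<close>

definition regular_at_scale ::
    "real \<Rightarrow> ('a::real_normed_vector \<Rightarrow> 'b::real_normed_vector set) \<Rightarrow> 'a \<Rightarrow> bool" where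
  "regular_at_scale N H x \<longleftrightarrow>
     (\<forall>a b. 0 < a \<longrightarrow> N * a \<le> 1 \<longrightarrow> 0 < b \<longrightarrow> N * b \<le> 1 \<longrightarrow> N * b \<le> a \<longrightarrow>
        single_valued_lipschitz_on N (cball 0 b) (\<lambda>y. setmap_inverse H y \<inter> cball x a))"

lemma regular_at_scale_mono:
  assumes "regular_at_scale N H x" "N \<le> M"
  shows "regular_at_scale M H x"
  unfolding regular_at_scale_def
proof (intro allI impI)
  fix a b :: real
  assume ab: "0 < a" "M * a \<le> 1" "0 < b" "M * b \<le> 1" "M * b \<le> a"
  \<comment> \<open>Radii admissible for \<open>M\<close> are admissible for \<open>N\<close>; the
    sign of \<open>N\<close> does not matter, as \<open>a\<close> and \<open>b\<close> are
    positive.\<close>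
  have "N * a \<le> M * a" "N * b \<le> M * b"
    using ab assms(2) by (auto intro: mult_right_mono)
  then have "N * a \<le> 1" "N * b \<le> 1" "N * b \<le> a"
    using ab by linarith+
  with ab assms(1)
  have "single_valued_lipschitz_on N (cball 0 b) (\<lambda>y. setmap_inverse H y \<inter> cball x a)"
    unfolding regular_at_scale_def by blast
  then show "single_valued_lipschitz_on M (cball 0 b) (\<lambda>y. setmap_inverse H y \<inter> cball x a)"
    using assms(2) by (rule single_valued_lipschitz_on_mono)
qed

text \<open>The values of the two maps at a point differ by the constant vector
  \<open>p t - p s\<close>, so every local question about time \<open>t\<close> becomes one about
  the fixed map at time \<open>s\<close>.\<close>

lemma setmap_inverse_gen_eq_map:
  "setmap_inverse (gen_eq_map f F p t) y = setmap_inverse (gen_eq_map f F p s) (y + (p t - p s))"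
proof -
  have "y = f x - p t + w \<longleftrightarrow> y + (p t - p s) = f x - p s + w" for x w
    by (auto simp: algebra_simps)
  then show ?thesis by (simp add: setmap_inverse_def gen_eq_map_def)
qed

lemma regular_at_scale_near:
  fixes f :: "'a::real_normed_vector \<Rightarrow> 'a"
  assumes reg: "strongly_metrically_regular (gen_eq_map f F p s) (z s) 0" and s: "s \<in> T"
    and cont: "continuous_on T z" "continuous_on T p"
    and sol: "\<And>t. t \<in> T \<Longrightarrow> z t \<in> solution_set f F p t"
  shows "\<exists>d>0. \<exists>N. \<forall>t\<in>T. dist t s < d \<longrightarrow> regular_at_scale N (gen_eq_map f F p t) (z t)"
proof -
  let ?G = "gen_eq_map f F p"
  obtain a\<^sub>0 b\<^sub>0 k where pos: "a\<^sub>0 > 0" "b\<^sub>0 > 0"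
    and loc: "single_valued_lipschitz_on k (cball 0 b\<^sub>0) (\<lambda>y. setmap_inverse (?G s) y \<inter> cball (z s) a\<^sub>0)"
    using reg unfolding strongly_metrically_regular_def by blast
  obtain d\<^sub>1 where d1: "d\<^sub>1 > 0" "\<And>t. t \<in> T \<Longrightarrow> dist t s < d\<^sub>1 \<Longrightarrow> dist (z t) (z s) < a\<^sub>0 / 2"
    using cont(1) s pos unfolding continuous_on_iff by (meson half_gt_zero)
  obtain d\<^sub>2 where d2: "d\<^sub>2 > 0" "\<And>t. t \<in> T \<Longrightarrow> dist t s < d\<^sub>2 \<Longrightarrow> dist (p t) (p s) < b\<^sub>0 / 2"
    using cont(2) s pos unfolding continuous_on_iff by (meson half_gt_zero)
  \<comment> \<open>The factors 2 force \<open>a \<le> a\<^sub>0 / 2\<close> and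
    \<open>b \<le> b\<^sub>0 / 2\<close>. The other halves absorb the displacements of
    \<open>z\<close> and \<open>p\<close> between \<open>s\<close> and \<open>t\<close>.\<close>
  define N where "N = Max {k, 2 / a\<^sub>0, 2 / b\<^sub>0}"
  have N: "k \<le> N" "2 / a\<^sub>0 \<le> N" "2 / b\<^sub>0 \<le> N" unfolding N_def by auto
  have "regular_at_scale N (?G t) (z t)" if t: "t \<in> T" "dist t s < min d\<^sub>1 d\<^sub>2" for t
    unfolding regular_at_scale_def
  proof (intro allI impI)
    fix a b :: real
    assume ab: "0 < a" "N * a \<le> 1" "0 < b" "N * b \<le> 1" "N * b \<le> a"
    have "2 / a\<^sub>0 * a \<le> 1" "2 / b\<^sub>0 * b \<le> 1" "k * b \<le> a"
      using ab N by (meson less_imp_le mult_right_mono order_trans)+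
    then have small: "a \<le> a\<^sub>0 / 2" "b \<le> b\<^sub>0 / 2" "k * b \<le> a"
      using pos by (auto simp: field_simps)
    have "z t \<in> setmap_inverse (?G t) 0"
      using sol[OF t(1)] by (simp add: solution_set_def setmap_inverse_def)
    \<comment> \<open>Being a solution at time \<open>t\<close> makes (\<open>z t\<close>,
      \<open>p t - p s\<close>) a point of the graph of \<open>?G s\<close>, which is the new
      reference point.\<close>
    then have "p t - p s \<in> ?G s (z t)"
      unfolding setmap_inverse_gen_eq_map[of f F p t 0 s] by (simp add: setmap_inverse_def)
    moreover have "dist (z s) (z t) + a \<le> a\<^sub>0"
      using d1(2)[OF t(1)] t(2) small by (simp add: dist_commute)
    moreover have "dist 0 (p t - p s) + b \<le> b\<^sub>0"
      using d2(2)[OF t(1)] t(2) small by (simp add: dist_norm norm_minus_commute)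
    ultimately have "single_valued_lipschitz_on k (cball (p t - p s) b)
        (\<lambda>y. setmap_inverse (?G s) y \<inter> cball (z t) a)"
      using inverse_localization_nearby[OF loc] small ab by simp
    from single_valued_lipschitz_on_translate[OF this]
    show "single_valued_lipschitz_on N (cball 0 b) (\<lambda>y. setmap_inverse (?G t) y \<inter> cball (z t) a)"
      unfolding setmap_inverse_gen_eq_map[of f F p t _ s]
      by (rule single_valued_lipschitz_on_mono[OF _ N(1)])
  qed
  with d1(1) d2(1) show ?thesis by (intro exI[of _ "min d\<^sub>1 d\<^sub>2"]) auto
qed

text \<open>A finite subcover leaves finitely many local scales, and by monotonicity their maximum
  works everywhere.\<close>

lemma compact_uniform_scale:
  fixes P :: "real \<Rightarrow> 'a::metric_space \<Rightarrow> bool"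
  assumes "compact T"
    and local: "\<And>s. s \<in> T \<Longrightarrow> \<exists>d>0. \<exists>N. \<forall>t\<in>T. dist t s < d \<longrightarrow> P N t"
    and mono: "\<And>N M t. P N t \<Longrightarrow> N \<le> M \<Longrightarrow> P M t"
  shows "\<exists>N. \<forall>M\<ge>N. \<forall>t\<in>T. P M t"
proof -
  obtain d N where d: "\<And>s. s \<in> T \<Longrightarrow> d s > 0"
    and N: "\<And>s t. s \<in> T \<Longrightarrow> t \<in> T \<Longrightarrow> dist t s < d s \<Longrightarrow> P (N s) t"
    using local by metis
  have "T \<subseteq> (\<Union>s\<in>T. ball s (d s))" using d by fastforce
  then obtain C where C: "C \<subseteq> T" "finite C" "T \<subseteq> (\<Union>s\<in>C. ball s (d s))"
    using compactE_image[OF \<open>compact T\<close>, of T "\<lambda>s. ball s (d s)"] by auto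
  \<comment> \<open>If \<open>C\<close> is empty, the unspecified \<open>Max\<close> is harmless,
    since then \<open>T\<close> is empty too.\<close>
  have "P M t" if M: "Max (N ` C) \<le> M" and t: "t \<in> T" for M t
  proof -
    obtain s where s: "s \<in> C" "dist t s < d s" using C(3) t by (auto simp: dist_commute)
    moreover have "N s \<le> Max (N ` C)" using C(2) s(1) by simp
    ultimately show ?thesis using N[of s t] C(1) t M by (meson mono order_trans subsetD)
  qed
  then show ?thesis by blast
qed

theorem theorem4p2p12:
  fixes f :: "real ^ 'n \<Rightarrow> real ^ 'n"
    and F :: "real ^ 'n \<Rightarrow> (real ^ 'n) set"
    and p z :: "real \<Rightarrow> real ^ 'n"
    and L\<^sub>z L\<^sub>p :: real
  assumes "L\<^sub>z-lipschitz_on {0..1} z"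
    and "\<forall>t\<in>{0..1}. z t \<in> solution_set f F p t"
    and "L\<^sub>p-lipschitz_on {0..1} p"
    and "\<forall>t\<in>{0..1}. strongly_metrically_regular (gen_eq_map f F p t) (z t) 0"
  shows "\<exists>a>0. \<exists>b>0. \<exists>\<kappa>>0. \<forall>t\<in>{0..1}.
           single_valued_lipschitz_on \<kappa> (cball 0 b)
             (\<lambda>y. setmap_inverse (gen_eq_map f F p t) y \<inter> cball (z t) a)"
proof -
  have cont: "continuous_on {0..1} z" "continuous_on {0..1} p"
    using assms(1,3) by (blast intro: lipschitz_on_continuous_on)+
  have "\<exists>N. \<forall>M\<ge>N. \<forall>t\<in>{0..1}. regular_at_scale M (gen_eq_map f F p t) (z t)"
  proof (rule compact_uniform_scale)
    show "compact {0..1::real}" by simp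
  next
    fix s :: real
    assume "s \<in> {0..1}"
    then show "\<exists>d>0. \<exists>N. \<forall>t\<in>{0..1}. dist t s < d \<longrightarrow> regular_at_scale N (gen_eq_map f F p t) (z t)"
      using assms(2,4) cont by (intro regular_at_scale_near) auto
  qed (rule regular_at_scale_mono)
  then obtain N where N: "\<And>M t. N \<le> M \<Longrightarrow> t \<in> {0..1} \<Longrightarrow> regular_at_scale M (gen_eq_map f F p t) (z t)"
    by blast
  \<comment> \<open>With \<open>a = 1 / M\<close> and \<open>b = 1 / (M * M)\<close> one has
    \<open>M * a = 1\<close> and \<open>M * b = a\<close>; the bound \<open>1 \<le> M\<close> makes
    the radii positive and yields \<open>M * b \<le> 1\<close>.\<close>
  define M where "M = max N 1"
  have M: "N \<le> M" "1 \<le> M" unfolding M_def by auto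
  have "single_valued_lipschitz_on M (cball 0 (1 / (M * M)))
      (\<lambda>y. setmap_inverse (gen_eq_map f F p t) y \<inter> cball (z t) (1 / M))" if "t \<in> {0..1}" for t
    using N[OF M(1) that] M(2) unfolding regular_at_scale_def by auto
  moreover have "1 / M > 0" "1 / (M * M) > 0" "M > 0" using M(2) by auto
  ultimately show ?thesis by blast
qed

end
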